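(* Fix a tree partition of $\omega$. Every tall trace-determined ideal on $\omega$ has property $\mathrm{Kat}$. In particular, the ideal $\mathcal H_{<\omega}=\bigcup_{n<\omega}\mathcal H_n$, each $\mathcal H^{\mathcal J}_\alpha$ with $1\le\alpha<\omega_1$ (for every proper ideal $\mathcal J\supseteq\mathrm{Fin}$ on $\omega$), the full ideal $\mathcal H^{\mathcal J}$ (for every such $\mathcal J$), and $\mathcal H$ have property $\mathrm{Kat}$.
   Context: All ideals are on countable sets, proper and contain all finite sets. A tree partition of $\omega$ is a family $\langle A_s:s\in\omega^{<\omega}\rangle$ of infinite subsets of $\omega$ such that $A_\varnothing=\omega$, for each $s$ the family $\{A_{s^\frown n}:n\in\omega\}$ is a partition of $A_s$, and any two distinct points of $\omega$ lie in different cells $A_s\neq A_t$ with $|s|=|t|=n$ for some $n$. For $X\subseteq\omega$ let $T^\infty_X=\{s\in\omega^{<\omega}:X\cap A_s\text{ is infinite}\}$. An ideal $\mathcal I$ on $\omega$ is trace-determined if $T^\infty_X=T^\infty_Y$ implies ($X\in\mathcal I\iff Y\in\mathcal I$). It is tall if every infinite subset of $\omega$ contains an infinite member of $\mathcal I$. $\mathcal I\le_K\mathcal K$ means there is $f:\operatorname{dom}(\mathcal K)\to\operatorname{dom}(\mathcal I)$ with $f^{-1}[A]\in\mathcal K$ for all $A\in\mathcal I$; $\mathcal I\sqsubseteq\mathcal K$ means such an $f$ can be taken bijective. $\mathcal I$ has property $\mathrm{Kat}$ if for every ideal $\mathcal K$, $\mathcal I\le_K\mathcal K$ implies $\mathcal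 I\sqsubseteq\mathcal K$. Derived ideals: for a proper ideal $\mathcal J\supseteq\mathrm{Fin}$ on $\omega$ and $T\subseteq\omega^{<\omega}$ put $\mathrm{Succ}_T(s)=\{n:s^\frown n\in T\}$ and $D_{\mathcal J}(T)=\{s\in T:\mathrm{Succ}_T(s)\notin\mathcal J\}$; $D^0_{\mathcal J}(T)=T$, $D^{\alpha+1}_{\mathcal J}(T)=D_{\mathcal J}(D^\alpha_{\mathcal J}(T))$, intersections at limits. $\mathcal H^{\mathcal J}_\alpha=\{X\subseteq\omega:\varnothing\notin D^\alpha_{\mathcal J}(T^\infty_X)\}$, $\mathcal H^{\mathcal J}=\bigcup_{\alpha<\omega_1}\mathcal H^{\mathcal J}_\alpha$, $\mathcal H_\alpha=\mathcal H^{\mathrm{Fin}}_\alpha$, $\mathcal H=\mathcal H^{\mathrm{Fin}}$. *)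

theory Defs
  imports "HOL-Library.Countable_Set_Type" "HOL-Library.FuncSet" "HOL-Library.Disjoint_Sets"
begin

section \<open>Ideals on countable sets\<close>

definition ideal_on :: "'a set \<Rightarrow> 'a set set \<Rightarrow> bool" where
  "ideal_on X I \<longleftrightarrow> countable X \<and> I \<subseteq> Pow X \<and>
     (\<forall>F. F \<subseteq> X \<and> finite F \<longrightarrow> F \<in> I) \<and>
     (\<forall>B\<in>I. \<forall>C. C \<subseteq> B \<longrightarrow> C \<in> I) \<and>
     (\<forall>B\<in>I. \<forall>C\<in>I. B \<union> C \<in> I) \<and>
     X \<notin> I"

definition tall :: "'a set \<Rightarrow> 'a set set \<Rightarrow> bool" where
  "tall X I \<longleftrightarrow> (\<forall>Y. Y \<subseteq> X \<and> infinite Y \<longrightarrow> (\<exists>B\<in>I. B \<subseteq> Y \<and> infinite B))"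

definition katetov_le :: "'a set \<Rightarrow> 'a set set \<Rightarrow> 'b set \<Rightarrow> 'b set set \<Rightarrow> bool" where
  "katetov_le X I Y K \<longleftrightarrow> (\<exists>f \<in> Y \<rightarrow> X. \<forall>B\<in>I. f -` B \<inter> Y \<in> K)"

definition bij_katetov_le :: "'a set \<Rightarrow> 'a set set \<Rightarrow> 'b set \<Rightarrow> 'b set set \<Rightarrow> bool" where
  "bij_katetov_le X I Y K \<longleftrightarrow> (\<exists>f. bij_betw f Y X \<and> (\<forall>B\<in>I. f -` B \<inter> Y \<in> K))"

text \<open>Katetov's property quantifies over all ideals on all countable sets. HOL cannot quantify
  over types inside a formula, so the type containing the underlying sets of the test ideals is a
  parameter; a theorem stated with a free type variable there covers every type.\<close>

definition has_Kat :: "'b itself \<Rightarrow> 'a set \<Rightarrow> 'a set set \<Rightarrow> bool" where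
  "has_Kat (ty :: 'b itself) X I \<longleftrightarrow> ideal_on X I \<and>
     (\<forall>(Y :: 'b set) K. ideal_on Y K \<and> katetov_le X I Y K \<longrightarrow> bij_katetov_le X I Y K)"


section \<open>Tree partitions\<close>

text \<open>Finite sequences of natural numbers are lists, and the extension of \<open>s\<close> by \<open>n\<close>
  is \<open>s @ [n]\<close>.\<close>

definition tree_partition :: "(nat list \<Rightarrow> nat set) \<Rightarrow> bool" where
  "tree_partition A \<longleftrightarrow>
     (\<forall>s. infinite (A s)) \<and>
     A [] = UNIV \<and>
     (\<forall>s. (\<Union>n. A (s @ [n])) = A s \<and> disjoint_family (\<lambda>n. A (s @ [n]))) \<and>
     (\<forall>x y. x \<noteq> y \<longrightarrow>
        (\<exists>n s t. length s = n \<and> length t = n \<and> A s \<noteq> A t \<and> x \<in> A s \<and> y \<in> A t))"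

definition Tinf :: "(nat list \<Rightarrow> nat set) \<Rightarrow> nat set \<Rightarrow> nat list set" where
  "Tinf A X = {s. infinite (X \<inter> A s)}"

definition trace_determined :: "(nat list \<Rightarrow> nat set) \<Rightarrow> nat set set \<Rightarrow> bool" where
  "trace_determined A I \<longleftrightarrow> (\<forall>X Y. Tinf A X = Tinf A Y \<longrightarrow> (X \<in> I \<longleftrightarrow> Y \<in> I))"


section \<open>The countable ordinals\<close>

text \<open>The cardinal successor of the standard well-order on the natural numbers is a well-order of
  type \<open>\<omega>\<^sub>1\<close>, so the elements of its field represent exactly the countable ordinals.\<close>

lemma cardSuc_natLeq_Well_order: "Well_order (cardSuc natLeq)"
  using cardSuc_Card_order[OF natLeq_Card_order] by (rule card_order_on_well_order_on)

lemma cardSuc_natLeq_infinite: "infinite (Field (cardSuc natLeq))"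
  using cardSuc_finite[OF natLeq_Card_order] by (simp add: Field_natLeq)

typedef omega1 = "Field (cardSuc natLeq)"
  using cardSuc_natLeq_infinite by (metis ex_in_conv finite.emptyI)

instantiation omega1 :: linorder
begin

definition less_eq_omega1 :: "omega1 \<Rightarrow> omega1 \<Rightarrow> bool" where
  "\<alpha> \<le> \<beta> \<longleftrightarrow> (Rep_omega1 \<alpha>, Rep_omega1 \<beta>) \<in> cardSuc natLeq"

definition less_omega1 :: "omega1 \<Rightarrow> omega1 \<Rightarrow> bool" where
  "\<alpha> < \<beta> \<longleftrightarrow> \<alpha> \<le> \<beta> \<and> \<not> \<beta> \<le> (\<alpha> :: omega1)"

instance
proof
  interpret wo_rel "cardSuc natLeq"
    by (simp add: wo_rel_def cardSuc_natLeq_Well_order)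
  fix x y z :: omega1
  show "x < y \<longleftrightarrow> x \<le> y \<and> \<not> y \<le> x" by (simp add: less_omega1_def)
  show "x \<le> x" using REFL Rep_omega1 by (auto simp: less_eq_omega1_def refl_on_def)
  show "x \<le> y \<Longrightarrow> y \<le> z \<Longrightarrow> x \<le> z" using TRANS by (auto simp: less_eq_omega1_def dest: transD)
  show "x \<le> y \<Longrightarrow> y \<le> x \<Longrightarrow> x = y"
    using ANTISYM by (auto simp: less_eq_omega1_def Rep_omega1_inject dest: antisymD)
  show "x \<le> y \<or> y \<le> x" using TOTALS Rep_omega1 by (auto simp: less_eq_omega1_def)
qed

end

lemma omega1_less_iff:
  "\<alpha> < \<beta> \<longleftrightarrow> (Rep_omega1 \<alpha>, Rep_omega1 \<beta>) \<in> cardSuc natLeq - Id"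
  unfolding less_le less_eq_omega1_def by (auto simp: Rep_omega1_inject)

instance omega1 :: wellorder
proof
  fix P :: "omega1 \<Rightarrow> bool" and a
  assume step: "\<And>x. (\<And>y. y < x \<Longrightarrow> P y) \<Longrightarrow> P x"
  have "wf (cardSuc natLeq - Id)"
    using cardSuc_natLeq_Well_order by (simp add: well_order_on_def)
  then have "wf (inv_image (cardSuc natLeq - Id) Rep_omega1)" by (rule wf_inv_image)
  then show "P a"
    by (rule wf_induct_rule) (auto intro: step simp: omega1_less_iff)
qed

lemma countable_lessThan_omega1: "countable {..<\<alpha> :: omega1}"
proof -
  let ?r = "cardSuc natLeq"
  have "(card_of (underS ?r (Rep_omega1 \<alpha>)), ?r) \<in> ordLess"
    using card_of_underS[OF cardSuc_Card_order[OF natLeq_Card_order] Rep_omega1] .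
  then have "(card_of (underS ?r (Rep_omega1 \<alpha>)), natLeq) \<in> ordLeq"
    using cardSuc_ordLeq_ordLess[OF natLeq_Card_order card_of_Card_order] by blast
  then have "countable (underS ?r (Rep_omega1 \<alpha>))"
    by (simp add: countable_card_le_natLeq)
  moreover have "Rep_omega1 ` {..<\<alpha>} \<subseteq> underS ?r (Rep_omega1 \<alpha>)"
    by (auto simp: underS_def omega1_less_iff)
  ultimately have "countable (Rep_omega1 ` {..<\<alpha>})" by (rule countable_subset[rotated])
  then show ?thesis by (rule countable_image_inj_on) (simp add: inj_on_def Rep_omega1_inject)
qed

lemma uncountable_omega1: "uncountable (UNIV :: omega1 set)"
proof
  assume "countable (UNIV :: omega1 set)"
  then have "countable (Field (cardSuc natLeq))"
    by (metis countable_image type_definition.Rep_range type_definition_omega1)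
  then have "(card_of (Field (cardSuc natLeq)), natLeq) \<in> ordLeq" by (simp add: countable_card_le_natLeq)
  moreover have "(natLeq, cardSuc natLeq) \<in> ordLess" by (rule cardSuc_greater[OF natLeq_Card_order])
  moreover have "(card_of (Field (cardSuc natLeq)), cardSuc natLeq) \<in> ordIso"
    by (rule card_of_Field_ordIso[OF cardSuc_Card_order[OF natLeq_Card_order]])
  ultimately show False
    by (meson not_ordLess_ordLeq ordIso_iff_ordLeq ordLeq_transitive)
qed

definition osucc :: "omega1 \<Rightarrow> omega1" where
  "osucc \<alpha> = (LEAST \<gamma>. \<alpha> < \<gamma>)"

instantiation omega1 :: "{zero, one}"
begin

definition zero_omega1 :: omega1 where "zero_omega1 = (LEAST \<alpha>. True)"

definition one_omega1 :: omega1 where "one_omega1 = osucc 0"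

instance ..

end

lemma zero_le_omega1 [simp]: "0 \<le> (\<alpha> :: omega1)"
  unfolding zero_omega1_def by (rule Least_le) simp

lemma less_osucc [simp]: "\<alpha> < osucc \<alpha>"
proof -
  have "\<exists>\<gamma>. \<alpha> < \<gamma>"
  proof (rule ccontr)
    assume "\<not> ?thesis"
    then have "(UNIV :: omega1 set) = insert \<alpha> {..<\<alpha>}" by (auto simp: not_less order_le_less)
    then show False
      using countable_lessThan_omega1[of \<alpha>] uncountable_omega1 by (metis countable_insert)
  qed
  then show ?thesis unfolding osucc_def by (rule LeastI_ex)
qed

lemma less_osucc_iff: "\<beta> < osucc \<alpha> \<longleftrightarrow> \<beta> \<le> \<alpha>"
proof
  show "\<beta> < osucc \<alpha> \<Longrightarrow> \<beta> \<le> \<alpha>" unfolding osucc_def by (metis not_less_Least not_less)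
  show "\<beta> \<le> \<alpha> \<Longrightarrow> \<beta> < osucc \<alpha>" by (erule le_less_trans) (rule less_osucc)
qed

lemma osucc_inject [simp]: "osucc \<alpha> = osucc \<beta> \<longleftrightarrow> \<alpha> = \<beta>"
  by (metis less_osucc less_osucc_iff order.antisym)

lemma osucc_neq_zero [simp]: "osucc \<alpha> \<noteq> 0"
  by (metis less_osucc leD zero_le_omega1)


section \<open>Derivatives and the derived ideals\<close>

definition Succs :: "nat list set \<Rightarrow> nat list \<Rightarrow> nat set" where
  "Succs T s = {n. s @ [n] \<in> T}"

definition tree_deriv :: "nat set set \<Rightarrow> nat list set \<Rightarrow> nat list set" where
  "tree_deriv J T = {s \<in> T. Succs T s \<notin> J}"

text \<open>\<open>D_iter J \<alpha> T\<close> is the \<open>\<alpha>\<close>-th iterate of \<open>tree_deriv J\<close> on \<open>T\<close>; the zero, successor and limit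
  clauses are recorded separately below.\<close>

function D_iter :: "nat set set \<Rightarrow> omega1 \<Rightarrow> nat list set \<Rightarrow> nat list set" where
  "D_iter J \<alpha> T =
     (if \<alpha> = 0 then T
      else if \<exists>\<beta>. \<alpha> = osucc \<beta> then tree_deriv J (D_iter J (THE \<beta>. \<alpha> = osucc \<beta>) T)
      else (\<Inter>\<beta>\<in>{..<\<alpha>}. D_iter J \<beta> T))"
  by auto
termination
proof (relation "inv_image {(\<beta>, \<alpha>). \<beta> < \<alpha>} (\<lambda>(J, \<alpha>, T). \<alpha>)")
  show "wf (inv_image {(\<beta>, \<alpha>). \<beta> < (\<alpha> :: omega1)} (\<lambda>(J :: nat set set, \<alpha>, T :: nat list set). \<alpha>))"
    by (rule wf_inv_image) (rule wf)
qed auto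

declare D_iter.simps [simp del]

lemma D_iter_zero: "D_iter J 0 T = T"
  by (subst D_iter.simps) simp

lemma D_iter_osucc: "D_iter J (osucc \<alpha>) T = tree_deriv J (D_iter J \<alpha> T)"
  by (subst D_iter.simps) simp

lemma D_iter_limit:
  assumes "L \<noteq> 0" and "\<And>\<beta>. L \<noteq> osucc \<beta>"
  shows "D_iter J L T = (\<Inter>\<beta>\<in>{..<L}. D_iter J \<beta> T)"
  using assms by (subst D_iter.simps) simp

definition Hideal :: "(nat list \<Rightarrow> nat set) \<Rightarrow> nat set set \<Rightarrow> omega1 \<Rightarrow> nat set set" where
  "Hideal A J \<alpha> = {X. [] \<notin> D_iter J \<alpha> (Tinf A X)}"

definition Hfull :: "(nat list \<Rightarrow> nat set) \<Rightarrow> nat set set \<Rightarrow> nat set set" where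
  "Hfull A J = (\<Union>\<alpha>. Hideal A J \<alpha>)"

abbreviation Fin :: "nat set set" where
  "Fin \<equiv> {F. finite F}"

definition H_less_omega :: "(nat list \<Rightarrow> nat set) \<Rightarrow> nat set set" where
  "H_less_omega A = (\<Union>n. Hideal A Fin ((osucc ^^ n) 0))"

end

theory Submission
  imports Defs
begin

text \<open>Let \<open>I\<close> be tall and trace-determined and let \<open>f\<close> witness \<open>I \<le>\<^sub>K K\<close> for an ideal \<open>K\<close> on \<open>Y\<close>.
  Enumerate \<open>Y\<close> and replace the value of \<open>f\<close> at the \<open>k\<close>-th point by a fresh point of the
  same level-\<open>k\<close> cell. Cells are infinite, so the resulting \<open>g\<close> can be made injective with
  coinfinite range, and for each fixed cell \<open>A t\<close> all but finitely many points that \<open>f\<close> sends into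
  \<open>A t\<close> are sent there by \<open>g\<close> as well. Hence, for \<open>B \<in> I\<close> and \<open>Z = g\<^sup>-\<^sup>1[B]\<close>, the set \<open>f[Z]\<close> meets a
  cell in an infinite set only if \<open>B\<close> does. A trace-determined ideal is downward closed with respect
  to inclusion of traces, so \<open>f[Z] \<in> I\<close> and therefore \<open>Z \<subseteq> f\<^sup>-\<^sup>1[f[Z]]\<close> lies in \<open>K\<close>
  (\<open>image_vimage_in_trace_determined\<close>).

  Tallness is what turns \<open>g\<close> into a bijection: the range of \<open>f\<close> is infinite because \<open>Y \<notin> K\<close>, so it
  contains an infinite member of \<open>I\<close>, whose preimage \<open>W\<close> is an infinite member of \<open>K\<close>. Changing \<open>g\<close>
  on \<open>W\<close> alters preimages only by subsets of \<open>W\<close>, and as the range of \<open>g\<close> is coinfinite,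
  \<open>W\<close> can be mapped bijectively onto everything that \<open>g\<close> misses outside \<open>W\<close>.

  The derived ideals are trace-determined by their very definition, so it remains to see that they
  are tall ideals. Closure under unions rests on the subadditivity of the iterated derivative
  (\<open>D_iter_Un_subset\<close>). Tallness is already witnessed by the first derivative: an infinite set
  \<open>Y\<close> either has infinite intersection with some cell of level \<open>1\<close>, in which case the trace of this
  intersection contains a single immediate successor of the root, or the trace of \<open>Y\<close> itself
  contains no such successor.\<close>

section \<open>Cells of a tree partition\<close>

lemma cell_append_subset:
  assumes "tree_partition A"
  shows "A (t @ u) \<subseteq> A t"
proof (induction u rule: rev_induct)
  case (snoc n u)
  have "A ((t @ u) @ [n]) \<subseteq> A (t @ u)"
    using assms unfolding tree_partition_def by blast
  with snoc show ?case by simp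
qed simp

lemma ex_cell_of_level:
  assumes "tree_partition A"
  shows "\<exists>s. length s = k \<and> x \<in> A s"
proof (induction k)
  case 0
  then show ?case using assms by (auto simp: tree_partition_def)
next
  case (Suc k)
  then obtain s where s: "length s = k" "x \<in> A s" by blast
  moreover have "(\<Union>n. A (s @ [n])) = A s"
    using assms by (simp add: tree_partition_def)
  ultimately obtain n where "x \<in> A (s @ [n])" by blast
  with s show ?case by (intro exI[of _ "s @ [n]"]) simp
qed

lemma cell_of_level_unique:
  assumes "tree_partition A"
  shows "length s = length t \<Longrightarrow> x \<in> A s \<Longrightarrow> x \<in> A t \<Longrightarrow> s = t"
proof (induction s arbitrary: t rule: rev_induct)
  case (snoc m s)
  then obtain t' n where t: "t = t' @ [n]" "length s = length t'"
    by (cases t rule: rev_cases) auto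
  have x: "x \<in> A (s @ [m])" "x \<in> A (t' @ [n])" using snoc.prems t by auto
  then have "s = t'"
    using snoc.IH[OF t(2)] cell_append_subset[OF assms] by blast
  moreover have "disjoint_family (\<lambda>n. A (s @ [n]))"
    using assms by (simp add: tree_partition_def)
  ultimately show ?case
    using x t by (auto simp: disjoint_family_on_def)
qed simp

lemma cell_subset_if_meets:
  assumes "tree_partition A" and "length t \<le> length s" and "x \<in> A s" and "x \<in> A t"
  shows "A s \<subseteq> A t"
proof -
  let ?t' = "take (length t) s"
  have sub: "A s \<subseteq> A ?t'"
    using cell_append_subset[OF assms(1), of ?t' "drop (length t) s"] by simp
  then have "?t' = t"
    using assms by (intro cell_of_level_unique[OF assms(1)]) auto
  with sub show ?thesis by simp
qed


section \<open>Tall trace-determined ideals\<close>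

lemma ideal_on_subset: "ideal_on X I \<Longrightarrow> B \<in> I \<Longrightarrow> C \<subseteq> B \<Longrightarrow> C \<in> I"
  by (simp add: ideal_on_def)

lemma ideal_on_Un: "ideal_on X I \<Longrightarrow> B \<in> I \<Longrightarrow> C \<in> I \<Longrightarrow> B \<union> C \<in> I"
  by (simp add: ideal_on_def)

text \<open>If \<open>Tinf A X \<subseteq> Tinf A Y\<close>, then \<open>X \<union> Y\<close> and \<open>Y\<close> have the same trace.\<close>

lemma trace_determined_mono:
  assumes "ideal_on UNIV I" and "trace_determined A I" and "Tinf A X \<subseteq> Tinf A Y" and "Y \<in> I"
  shows "X \<in> I"
proof -
  have "Tinf A (X \<union> Y) = Tinf A Y"
    using assms(3) by (auto simp: Tinf_def Int_Un_distrib2)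
  then have "X \<union> Y \<in> I"
    using assms(2,4) unfolding trace_determined_def by blast
  then show ?thesis
    by (rule ideal_on_subset[OF assms(1)]) simp
qed

lemma image_vimage_in_trace_determined:
  assumes I: "ideal_on UNIV I" "trace_determined A I"
    and inj: "inj_on g Y"
    and close: "\<And>t. finite {y \<in> Y. f y \<in> A t \<and> g y \<notin> A t}"
    and B: "B \<in> I"
  shows "f ` (g -` B \<inter> Y) \<in> I"
proof (rule trace_determined_mono[OF I _ B])
  show "Tinf A (f ` (g -` B \<inter> Y)) \<subseteq> Tinf A B"
  proof
    fix t
    assume "t \<in> Tinf A (f ` (g -` B \<inter> Y))"
    then have "infinite (f ` (g -` B \<inter> Y) \<inter> A t)" by (simp add: Tinf_def)
    moreover have "f ` (g -` B \<inter> Y) \<inter> A t \<subseteq> f ` {y \<in> Y. g y \<in> B \<and> f y \<in> A t}" by auto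
    ultimately have "infinite {y \<in> Y. g y \<in> B \<and> f y \<in> A t}"
      using finite_surj by blast
    then have "infinite ({y \<in> Y. g y \<in> B \<and> f y \<in> A t} - {y \<in> Y. f y \<in> A t \<and> g y \<notin> A t})"
      using close by (rule Diff_infinite_finite[rotated])
    then have "infinite {y \<in> Y. g y \<in> B \<inter> A t}"
      by (rule infinite_super[rotated]) auto
    moreover have "inj_on g {y \<in> Y. g y \<in> B \<inter> A t}"
      by (rule inj_on_subset[OF inj]) auto
    ultimately have "infinite (g ` {y \<in> Y. g y \<in> B \<inter> A t})"
      by (simp add: finite_image_iff)
    then have "infinite (B \<inter> A t)"
      by (rule infinite_super[rotated]) auto
    then show "t \<in> Tinf A B" by (simp add: Tinf_def)
  qed
qed

lemma ex_injective_choice: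
  fixes C :: "nat \<Rightarrow> 'a set"
  assumes "\<And>k. infinite (C k)"
  shows "\<exists>h. inj h \<and> (\<forall>k. h k \<in> C k)"
proof -
  have "\<exists>h. \<forall>k. h k \<in> C k \<and> h k \<notin> h ` {..<k}"
  proof (rule dependent_wellorder_choice)
    fix h :: "nat \<Rightarrow> 'a" and k
    have "infinite (C k - h ` {..<k})"
      using assms by (simp add: Diff_infinite_finite)
    then show "\<exists>r. r \<in> C k \<and> r \<notin> h ` {..<k}"
      by (metis Diff_iff ex_in_conv finite.emptyI)
  next
    fix r k and h h' :: "nat \<Rightarrow> 'a"
    assume "\<And>j. j < k \<Longrightarrow> h j = h' j"
    then show "(r \<in> C k \<and> r \<notin> h ` {..<k}) = (r \<in> C k \<and> r \<notin> h' ` {..<k})"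
      by (simp cong: image_cong_simp)
  qed
  then obtain h where h: "\<And>k. h k \<in> C k" "\<And>k. h k \<notin> h ` {..<k}" by blast
  have "inj h"
    by (rule linorder_injI) (metis h(2) imageI lessThan_iff)
  with h(1) show ?thesis by blast
qed

text \<open>The \<open>k\<close>-th point of \<open>Y\<close> is sent into the level-\<open>k\<close> cell of its \<open>f\<close>-image; only the
  first \<open>length t\<close> points can then violate the condition for \<open>A t\<close>.\<close>

lemma ex_cellwise_close_injection:
  fixes f :: "'b \<Rightarrow> nat"
  assumes A: "tree_partition A" and Y: "countable Y"
  shows "\<exists>g. inj_on g Y \<and> infinite (- g ` Y) \<and> (\<forall>t. finite {y \<in> Y. f y \<in> A t \<and> g y \<notin> A t})"
proof -
  let ?e = "to_nat_on Y"
  have "\<forall>y. \<exists>s. length s = ?e y \<and> f y \<in> A s"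
    using ex_cell_of_level[OF A] by blast
  then obtain s where s: "\<And>y. length (s y) = ?e y" "\<And>y. f y \<in> A (s y)" by metis
  \<comment> \<open>Even indices provide the values of \<open>g\<close>; odd ones reserve infinitely many points outside
    its range.\<close>
  define C where "C j = (if even j then A (s (from_nat_into Y (j div 2))) else UNIV)" for j :: nat
  have "infinite (C j)" for j
    using A by (simp add: C_def tree_partition_def)
  then obtain h where h: "inj h" "\<And>j. h j \<in> C j"
    using ex_injective_choice by metis
  define g where "g y = h (2 * ?e y)" for y
  have g_cell: "g y \<in> A (s y)" if "y \<in> Y" for y
    using h(2)[of "2 * ?e y"] that Y by (simp add: g_def C_def)
  have inj: "inj_on g Y"
  proof (rule inj_onI)
    fix x y
    assume "x \<in> Y" "y \<in> Y" "g x = g y"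
    then have "?e x = ?e y" using injD[OF h(1)] by (simp add: g_def) fastforce
    then show "x = y" using inj_on_to_nat_on[OF Y] \<open>x \<in> Y\<close> \<open>y \<in> Y\<close> by (simp add: inj_on_eq_iff)
  qed
  have "infinite (range (\<lambda>n. h (2 * n + 1)))"
    using injD[OF h(1)] by (intro range_inj_infinite injI) fastforce
  moreover have "range (\<lambda>n. h (2 * n + 1)) \<subseteq> - g ` Y"
    unfolding g_def by (auto dest!: injD[OF h(1)]) presburger
  ultimately have coinf: "infinite (- g ` Y)"
    by (rule infinite_super[rotated])
  have "finite {y \<in> Y. f y \<in> A t \<and> g y \<notin> A t}" for t
  proof (rule inj_on_finite)
    show "inj_on ?e {y \<in> Y. f y \<in> A t \<and> g y \<notin> A t}"
      by (rule inj_on_subset[OF inj_on_to_nat_on[OF Y]]) auto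
    show "?e ` {y \<in> Y. f y \<in> A t \<and> g y \<notin> A t} \<subseteq> {..<length t}"
    proof clarsimp
      fix y
      assume y: "y \<in> Y" "f y \<in> A t" "g y \<notin> A t"
      show "?e y < length t"
      proof (rule ccontr)
        assume "\<not> ?e y < length t"
        then have "A (s y) \<subseteq> A t"
          using cell_subset_if_meets[OF A, of t "s y" "f y"] s y by simp
        then show False using g_cell y by blast
      qed
    qed
  qed simp
  with inj coinf show ?thesis by blast
qed

lemma katetov_reduction_ex_infinite_small:
  assumes I: "ideal_on X I" "tall X I" and K: "ideal_on Y K"
    and f: "f \<in> Y \<rightarrow> X" "\<And>B. B \<in> I \<Longrightarrow> f -` B \<inter> Y \<in> K"
  obtains W where "W \<in> K" "W \<subseteq> Y" "infinite W"
proof -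
  have "infinite (f ` Y)"
  proof
    assume "finite (f ` Y)"
    then have "f ` Y \<in> I" using I(1) f(1) by (simp add: ideal_on_def image_subset_iff_funcset)
    then have "f -` (f ` Y) \<inter> Y \<in> K" by (rule f(2))
    moreover have "f -` (f ` Y) \<inter> Y = Y" by auto
    ultimately show False using K unfolding ideal_on_def by simp
  qed
  then obtain B where B: "B \<in> I" "B \<subseteq> f ` Y" "infinite B"
    using I(2) f(1) unfolding tall_def by (metis image_subset_iff_funcset)
  have "B \<subseteq> f ` (f -` B \<inter> Y)" using B(2) by auto
  then have "infinite (f -` B \<inter> Y)" using B(3) finite_surj by blast
  then show ?thesis using that f(2)[OF B(1)] by blast
qed

text \<open>Off the infinite set \<open>W\<close>, the given injection is kept; \<open>W\<close> absorbs the rest of the target.\<close>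

lemma injection_modify_to_bijection:
  fixes g :: "'b \<Rightarrow> nat"
  assumes "inj_on g Y" and "infinite (- g ` Y)" and "countable Y" and "W \<subseteq> Y" and "infinite W"
  shows "\<exists>h. bij_betw h Y UNIV \<and> (\<forall>y \<in> Y - W. h y = g y)"
proof -
  let ?R = "- g ` (Y - W)"
  have inf: "infinite ?R"
    using assms(2) by (rule infinite_super[rotated]) auto
  have "countable W" using assms(3,4) by (rule countable_subset[rotated])
  then have "bij_betw (to_nat_on W) W UNIV"
    using assms(5) by (rule to_nat_on_infinite)
  moreover have "bij_betw (from_nat_into ?R) UNIV ?R"
    using inf by (intro bij_betw_from_nat_into) auto
  ultimately have k: "bij_betw (from_nat_into ?R \<circ> to_nat_on W) W ?R"
    by (rule bij_betw_trans)
  have g: "bij_betw g (Y - W) (g ` (Y - W))"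
    using assms(1) by (intro inj_on_imp_bij_betw) (rule inj_on_subset, auto)
  let ?h = "\<lambda>y. if y \<in> Y - W then g y else (from_nat_into ?R \<circ> to_nat_on W) y"
  have "bij_betw ?h ((Y - W) \<union> W) (g ` (Y - W) \<union> ?R)"
    by (rule bij_betw_disjoint_Un[OF g k]) auto
  moreover have "(Y - W) \<union> W = Y" "g ` (Y - W) \<union> ?R = UNIV" using assms(4) by auto
  ultimately have "bij_betw ?h Y UNIV" by simp
  then show ?thesis by (intro exI[of _ ?h]) auto
qed

theorem tall_trace_determined_has_Kat:
  fixes I :: "nat set set"
  assumes A: "tree_partition A"
    and I: "ideal_on UNIV I" "tall UNIV I" "trace_determined A I"
  shows "has_Kat TYPE('b) UNIV I"
  unfolding has_Kat_def
proof (intro conjI allI impI I(1), elim conjE)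
  fix Y :: "'b set" and K
  assume K: "ideal_on Y K" and "katetov_le UNIV I Y K"
  then obtain f where f: "f \<in> Y \<rightarrow> UNIV" "\<And>B. B \<in> I \<Longrightarrow> f -` B \<inter> Y \<in> K"
    unfolding katetov_le_def by blast
  have Y: "countable Y" using K by (simp add: ideal_on_def)
  obtain W where W: "W \<in> K" "W \<subseteq> Y" "infinite W"
    using katetov_reduction_ex_infinite_small[OF I(1,2) K f] by blast
  obtain g where g: "inj_on g Y" "infinite (- g ` Y)"
      "\<And>t. finite {y \<in> Y. f y \<in> A t \<and> g y \<notin> A t}"
    using ex_cellwise_close_injection[OF A Y] by metis
  obtain h where h: "bij_betw h Y UNIV" "\<forall>y \<in> Y - W. h y = g y"
    using injection_modify_to_bijection[OF g(1,2) Y W(2,3)] by blast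
  have "h -` B \<inter> Y \<in> K" if "B \<in> I" for B
  proof -
    have "f -` (f ` (g -` B \<inter> Y)) \<inter> Y \<in> K"
      using image_vimage_in_trace_determined[OF I(1,3) g(1,3) that] by (rule f(2))
    then have "f -` (f ` (g -` B \<inter> Y)) \<inter> Y \<union> W \<in> K"
      using W(1) by (rule ideal_on_Un[OF K])
    then show ?thesis
      by (rule ideal_on_subset[OF K]) (use h(2) in auto)
  qed
  with h(1) show "bij_katetov_le UNIV I Y K"
    unfolding bij_katetov_le_def by blast
qed


section \<open>Iterated derivatives\<close>

lemma omega1_induct [case_names zero osucc limit]:
  fixes \<alpha> :: omega1
  assumes "P 0" and "\<And>\<beta>. P \<beta> \<Longrightarrow> P (osucc \<beta>)"
    and "\<And>L. L \<noteq> 0 \<Longrightarrow> (\<And>\<beta>. L \<noteq> osucc \<beta>) \<Longrightarrow> (\<And>\<beta>. \<beta> < L \<Longrightarrow> P \<beta>) \<Longrightarrow> P L"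
  shows "P \<alpha>"
proof (induction \<alpha> rule: less_induct)
  case (less \<alpha>)
  consider "\<alpha> = 0" | \<beta> where "\<alpha> = osucc \<beta>" | "\<alpha> \<noteq> 0" "\<And>\<beta>. \<alpha> \<noteq> osucc \<beta>" by blast
  then show ?case using assms less by cases auto
qed

lemma tree_deriv_subset: "tree_deriv J T \<subseteq> T"
  by (auto simp: tree_deriv_def)

lemma tree_deriv_mono:
  assumes "ideal_on UNIV J" and "S \<subseteq> T"
  shows "tree_deriv J S \<subseteq> tree_deriv J T"
proof
  fix s
  assume "s \<in> tree_deriv J S"
  then have s: "s \<in> S" "Succs S s \<notin> J" by (auto simp: tree_deriv_def)
  moreover have "Succs S s \<subseteq> Succs T s" using assms(2) by (auto simp: Succs_def)
  ultimately have "Succs T s \<notin> J" using ideal_on_subset[OF assms(1)] by blast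
  with s assms(2) show "s \<in> tree_deriv J T" by (auto simp: tree_deriv_def)
qed

lemma D_iter_antimono: "\<beta> \<le> \<alpha> \<Longrightarrow> D_iter J \<alpha> T \<subseteq> D_iter J \<beta> T"
proof (induction \<alpha> rule: omega1_induct)
  case zero
  then show ?case by (metis order.antisym order.refl zero_le_omega1)
next
  case (osucc \<gamma>)
  show ?case
  proof (cases "\<beta> = osucc \<gamma>")
    case False
    then have "\<beta> \<le> \<gamma>" using osucc.prems by (metis less_osucc_iff order_le_less)
    then show ?thesis
      using osucc.IH tree_deriv_subset by (fastforce simp: D_iter_osucc)
  qed simp
next
  case (limit L)
  then show ?case by (cases "\<beta> = L") (auto simp: D_iter_limit)
qed

lemma D_iter_mono:
  assumes "ideal_on UNIV J" and "S \<subseteq> T"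
  shows "D_iter J \<alpha> S \<subseteq> D_iter J \<alpha> T"
proof (induction \<alpha> rule: omega1_induct)
  case zero
  then show ?case using assms by (simp add: D_iter_zero)
next
  case (osucc \<beta>)
  then show ?case by (simp add: D_iter_osucc tree_deriv_mono[OF assms(1)])
next
  case (limit L)
  then show ?case by (subst (1 2) D_iter_limit) auto
qed

lemma D_iter_UNIV:
  assumes "ideal_on UNIV J"
  shows "D_iter J \<alpha> UNIV = UNIV"
proof (induction \<alpha> rule: omega1_induct)
  case (osucc \<beta>)
  then show ?case using assms by (simp add: D_iter_osucc tree_deriv_def Succs_def ideal_on_def)
next
  case (limit L)
  then show ?case by (simp add: D_iter_limit)
qed (simp add: D_iter_zero)

text \<open>The derivative of a tree need not be closed under initial segments, so the iteration leaves the
  class of trees. What survives is that a sequence with \<open>J\<close>-positively many immediate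
  successors in the set belongs to the set itself; this is all that subadditivity requires.\<close>

definition positive_closed :: "nat set set \<Rightarrow> nat list set \<Rightarrow> bool" where
  "positive_closed J T \<longleftrightarrow> (\<forall>s. Succs T s \<notin> J \<longrightarrow> s \<in> T)"

lemma positive_closed_D_iter:
  assumes J: "ideal_on UNIV J" and "positive_closed J T"
  shows "positive_closed J (D_iter J \<alpha> T)"
proof (induction \<alpha> rule: omega1_induct)
  case zero
  then show ?case using assms by (simp add: D_iter_zero)
next
  case (osucc \<beta>)
  let ?T = "D_iter J \<beta> T"
  have "s \<in> tree_deriv J ?T" if "Succs (tree_deriv J ?T) s \<notin> J" for s
  proof -
    have "Succs (tree_deriv J ?T) s \<subseteq> Succs ?T s" by (auto simp: Succs_def tree_deriv_def)
    then have "Succs ?T s \<notin> J" using ideal_on_subset[OF J] that by blast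
    then show ?thesis using osucc by (simp add: positive_closed_def tree_deriv_def)
  qed
  then show ?case by (simp add: positive_closed_def D_iter_osucc)
next
  case (limit L)
  have "s \<in> D_iter J \<beta> T" if "Succs (D_iter J L T) s \<notin> J" "\<beta> < L" for s \<beta>
  proof -
    have "Succs (D_iter J L T) s \<subseteq> Succs (D_iter J \<beta> T) s"
      using D_iter_antimono[OF less_imp_le[OF \<open>\<beta> < L\<close>], of J T] by (auto simp: Succs_def)
    then have "Succs (D_iter J \<beta> T) s \<notin> J" using ideal_on_subset[OF J] that(1) by blast
    then show ?thesis using limit.IH[OF \<open>\<beta> < L\<close>] by (simp add: positive_closed_def)
  qed
  then show ?case using limit.hyps by (auto simp: positive_closed_def D_iter_limit)
qed

lemma tree_deriv_Un_subset:
  assumes J: "ideal_on UNIV J" and "positive_closed J S" "positive_closed J T"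
  shows "tree_deriv J (S \<union> T) \<subseteq> tree_deriv J S \<union> tree_deriv J T"
proof
  fix s
  assume "s \<in> tree_deriv J (S \<union> T)"
  then have "Succs S s \<union> Succs T s \<notin> J"
    by (simp add: tree_deriv_def Succs_def Collect_disj_eq)
  then have "Succs S s \<notin> J \<or> Succs T s \<notin> J" using ideal_on_Un[OF J] by blast
  then show "s \<in> tree_deriv J S \<union> tree_deriv J T"
    using assms(2,3) by (auto simp: positive_closed_def tree_deriv_def)
qed

lemma D_iter_Un_subset:
  assumes J: "ideal_on UNIV J" and S: "positive_closed J S" and T: "positive_closed J T"
  shows "D_iter J \<alpha> (S \<union> T) \<subseteq> D_iter J \<alpha> S \<union> D_iter J \<alpha> T"
proof (induction \<alpha> rule: omega1_induct)
  case zero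
  then show ?case by (simp add: D_iter_zero)
next
  case (osucc \<beta>)
  have "tree_deriv J (D_iter J \<beta> (S \<union> T)) \<subseteq> tree_deriv J (D_iter J \<beta> S \<union> D_iter J \<beta> T)"
    using J osucc by (rule tree_deriv_mono)
  also have "\<dots> \<subseteq> tree_deriv J (D_iter J \<beta> S) \<union> tree_deriv J (D_iter J \<beta> T)"
    using positive_closed_D_iter[OF J S] positive_closed_D_iter[OF J T]
    by (rule tree_deriv_Un_subset[OF J])
  finally show ?case by (simp add: D_iter_osucc)
next
  case (limit L)
  \<comment> \<open>If \<open>s\<close> has dropped out of both iterations, it is in neither at the later of the two stages.\<close>
  have "s \<in> (\<Inter>\<beta>\<in>{..<L}. D_iter J \<beta> S) \<union> (\<Inter>\<beta>\<in>{..<L}. D_iter J \<beta> T)"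
    if s: "s \<in> (\<Inter>\<beta>\<in>{..<L}. D_iter J \<beta> (S \<union> T))" for s
  proof (rule ccontr)
    assume "\<not> ?thesis"
    then obtain \<beta> \<gamma> where bg: "\<beta> < L" "s \<notin> D_iter J \<beta> S" "\<gamma> < L" "s \<notin> D_iter J \<gamma> T" by auto
    then have "max \<beta> \<gamma> < L" by simp
    then have "s \<in> D_iter J (max \<beta> \<gamma>) S \<union> D_iter J (max \<beta> \<gamma>) T"
      using s limit.IH by blast
    then show False
      using bg D_iter_antimono[of \<beta> "max \<beta> \<gamma>" J S] D_iter_antimono[of \<gamma> "max \<beta> \<gamma>" J T]
      by auto
  qed
  then show ?case using limit.hyps by (simp add: D_iter_limit subset_iff)
qed


section \<open>The derived ideals\<close>

lemma Tinf_Un: "Tinf A (X \<union> Y) = Tinf A X \<union> Tinf A Y"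
  by (auto simp: Tinf_def Int_Un_distrib2)

lemma positive_closed_Tinf:
  assumes "tree_partition A" and "ideal_on UNIV J"
  shows "positive_closed J (Tinf A X)"
  unfolding positive_closed_def
proof (intro allI impI)
  fix s
  assume "Succs (Tinf A X) s \<notin> J"
  then have "Succs (Tinf A X) s \<noteq> {}" using assms(2) by (auto simp: ideal_on_def)
  then obtain n where n: "infinite (X \<inter> A (s @ [n]))" by (auto simp: Succs_def Tinf_def)
  have "X \<inter> A (s @ [n]) \<subseteq> X \<inter> A s"
    using cell_append_subset[OF assms(1), of s "[n]"] by blast
  then have "infinite (X \<inter> A s)" using n by (rule infinite_super)
  then show "s \<in> Tinf A X" by (simp add: Tinf_def)
qed

lemma Hideal_mono: "\<alpha> \<le> \<beta> \<Longrightarrow> Hideal A J \<alpha> \<subseteq> Hideal A J \<beta>"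
  using D_iter_antimono by (fastforce simp: Hideal_def)

lemma Hideal_Un:
  assumes "tree_partition A" and "ideal_on UNIV J" and "X \<in> Hideal A J \<alpha>" and "Y \<in> Hideal A J \<alpha>"
  shows "X \<union> Y \<in> Hideal A J \<alpha>"
proof -
  have "D_iter J \<alpha> (Tinf A (X \<union> Y)) \<subseteq> D_iter J \<alpha> (Tinf A X) \<union> D_iter J \<alpha> (Tinf A Y)"
    unfolding Tinf_Un
    by (intro D_iter_Un_subset positive_closed_Tinf assms)
  then show ?thesis using assms(3,4) by (auto simp: Hideal_def)
qed

lemma finite_in_Hideal:
  assumes "finite X"
  shows "X \<in> Hideal A J \<alpha>"
proof -
  have "D_iter J \<alpha> (Tinf A X) \<subseteq> Tinf A X"
    using D_iter_antimono[of 0 \<alpha> J] by (simp add: D_iter_zero)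
  moreover have "Tinf A X = {}" using assms by (simp add: Tinf_def)
  ultimately show ?thesis by (simp add: Hideal_def)
qed

lemma UNIV_notin_Hideal:
  assumes "tree_partition A" and "ideal_on UNIV J"
  shows "UNIV \<notin> Hideal A J \<alpha>"
proof -
  have "Tinf A UNIV = UNIV" using assms(1) by (simp add: Tinf_def tree_partition_def)
  then show ?thesis using D_iter_UNIV[OF assms(2)] by (simp add: Hideal_def)
qed

text \<open>The ideals increase with \<open>\<alpha>\<close>, so two members of the union lie in a common stage. Taking \<open>S\<close>
  to be a singleton, the finite ordinals or all countable ordinals covers every derived ideal
  at once.\<close>

lemma ideal_on_UN_Hideal:
  assumes A: "tree_partition A" and J: "ideal_on UNIV J" and "S \<noteq> {}"
  shows "ideal_on UNIV (\<Union>\<alpha>\<in>S. Hideal A J \<alpha>)"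
proof -
  have Un: "X \<union> Y \<in> (\<Union>\<alpha>\<in>S. Hideal A J \<alpha>)"
    if XY: "X \<in> (\<Union>\<alpha>\<in>S. Hideal A J \<alpha>)" "Y \<in> (\<Union>\<alpha>\<in>S. Hideal A J \<alpha>)" for X Y
  proof -
    obtain \<alpha> \<beta> where ab: "\<alpha> \<in> S" "X \<in> Hideal A J \<alpha>" "\<beta> \<in> S" "Y \<in> Hideal A J \<beta>"
      using XY by blast
    then have "X \<in> Hideal A J (max \<alpha> \<beta>)" "Y \<in> Hideal A J (max \<alpha> \<beta>)"
      using Hideal_mono[of _ "max \<alpha> \<beta>" A J] by (meson max.cobounded1 max.cobounded2 subsetD)+
    then have "X \<union> Y \<in> Hideal A J (max \<alpha> \<beta>)" by (rule Hideal_Un[OF A J])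
    moreover have "max \<alpha> \<beta> \<in> S" using ab by (simp add: max_def)
    ultimately show ?thesis by blast
  qed
  have subset: "C \<in> (\<Union>\<alpha>\<in>S. Hideal A J \<alpha>)"
    if B: "B \<in> (\<Union>\<alpha>\<in>S. Hideal A J \<alpha>)" and "C \<subseteq> B" for B C
  proof -
    obtain \<alpha> where \<alpha>: "\<alpha> \<in> S" "B \<in> Hideal A J \<alpha>" using B by blast
    have "Tinf A C \<subseteq> Tinf A B" using \<open>C \<subseteq> B\<close> Tinf_Un[of A C B] by (auto simp: Un_absorb1)
    then have "C \<in> Hideal A J \<alpha>"
      using \<alpha>(2) D_iter_mono[OF J, of _ _ \<alpha>] by (auto simp: Hideal_def)
    with \<alpha>(1) show ?thesis by blast
  qed
  have "F \<in> (\<Union>\<alpha>\<in>S. Hideal A J \<alpha>)" if "finite F" for F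
    using \<open>S \<noteq> {}\<close> finite_in_Hideal[OF that] by auto
  moreover have "UNIV \<notin> (\<Union>\<alpha>\<in>S. Hideal A J \<alpha>)"
    using UNIV_notin_Hideal[OF A J] by blast
  ultimately show ?thesis
    unfolding ideal_on_def using subset Un by (intro conjI ballI allI impI) simp_all
qed

lemma tall_Hideal_one:
  assumes A: "tree_partition A" and J: "ideal_on UNIV J"
  shows "tall UNIV (Hideal A J 1)"
  unfolding tall_def
proof (intro allI impI)
  fix Y :: "nat set"
  assume Y: "Y \<subseteq> UNIV \<and> infinite Y"
  have in_Hideal: "X \<in> Hideal A J 1" if "finite (Succs (Tinf A X) [])" for X
    using J that
    by (simp add: Hideal_def one_omega1_def D_iter_osucc D_iter_zero tree_deriv_def ideal_on_def)
  show "\<exists>B\<in>Hideal A J 1. B \<subseteq> Y \<and> infinite B"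
  proof (cases "\<exists>n. infinite (Y \<inter> A [n])")
    case True
    then obtain n where n: "infinite (Y \<inter> A [n])" by blast
    have "m = n" if inf: "infinite (Y \<inter> A [n] \<inter> A [m])" for m
    proof -
      obtain x where "x \<in> A [n]" "x \<in> A [m]" using infinite_imp_nonempty[OF inf] by blast
      then show ?thesis using cell_of_level_unique[OF A, of "[m]" "[n]"] by simp
    qed
    then have "Succs (Tinf A (Y \<inter> A [n])) [] \<subseteq> {n}" by (auto simp: Succs_def Tinf_def)
    then have "Y \<inter> A [n] \<in> Hideal A J 1" by (intro in_Hideal) (rule finite_subset, auto)
    with n show ?thesis by blast
  next
    case False
    then have "Succs (Tinf A Y) [] = {}" by (auto simp: Succs_def Tinf_def)
    then have "Y \<in> Hideal A J 1" by (intro in_Hideal) simp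
    with Y show ?thesis by blast
  qed
qed

lemma has_Kat_UN_Hideal:
  assumes A: "tree_partition A" and J: "ideal_on UNIV J" and S: "\<alpha> \<in> S" "1 \<le> \<alpha>"
  shows "has_Kat TYPE('b) UNIV (\<Union>\<alpha>\<in>S. Hideal A J \<alpha>)"
proof (rule tall_trace_determined_has_Kat[OF A])
  show "ideal_on UNIV (\<Union>\<alpha>\<in>S. Hideal A J \<alpha>)"
    using S by (intro ideal_on_UN_Hideal A J) auto
  have "Hideal A J 1 \<subseteq> (\<Union>\<alpha>\<in>S. Hideal A J \<alpha>)"
    using Hideal_mono[OF S(2)] S(1) by blast
  then show "tall UNIV (\<Union>\<alpha>\<in>S. Hideal A J \<alpha>)"
    using tall_Hideal_one[OF A J] unfolding tall_def by (meson subsetD)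
  show "trace_determined A (\<Union>\<alpha>\<in>S. Hideal A J \<alpha>)"
    by (simp add: trace_determined_def Hideal_def)
qed

theorem theorem4p22:
  fixes A :: "nat list \<Rightarrow> nat set"
  assumes "tree_partition A"
  shows
    "(\<forall>I :: nat set set. ideal_on UNIV I \<and> tall UNIV I \<and> trace_determined A I
        \<longrightarrow> has_Kat TYPE('b) UNIV I) \<and>
     has_Kat TYPE('b) UNIV (H_less_omega A) \<and>
     (\<forall>J. ideal_on UNIV J \<longrightarrow> (\<forall>\<alpha> :: omega1. 1 \<le> \<alpha> \<longrightarrow> has_Kat TYPE('b) UNIV (Hideal A J \<alpha>))) \<and>
     (\<forall>J. ideal_on UNIV J \<longrightarrow> has_Kat TYPE('b) UNIV (Hfull A J)) \<and>
     has_Kat TYPE('b) UNIV (Hfull A Fin)"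
proof -
  have Fin: "ideal_on UNIV Fin"
    by (auto simp: ideal_on_def intro: finite_subset)
  have "(1 :: omega1) \<in> range (\<lambda>n. (osucc ^^ n) 0)"
    by (rule range_eqI[of _ _ 1]) (simp add: one_omega1_def)
  then have "has_Kat TYPE('b) UNIV (H_less_omega A)"
    using has_Kat_UN_Hideal[OF assms Fin, of 1 "range (\<lambda>n. (osucc ^^ n) 0)"]
    by (simp add: H_less_omega_def)
  moreover have "has_Kat TYPE('b) UNIV (Hideal A J \<alpha>)" if "ideal_on UNIV J" "1 \<le> \<alpha>" for J \<alpha>
    using has_Kat_UN_Hideal[OF assms that(1), of \<alpha> "{\<alpha>}"] that(2) by simp
  moreover have "has_Kat TYPE('b) UNIV (Hfull A J)" if "ideal_on UNIV J" for J
    using has_Kat_UN_Hideal[OF assms that, of 1 UNIV] by (simp add: Hfull_def)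
  ultimately show ?thesis
    using tall_trace_determined_has_Kat[OF assms] Fin by blast
qed

end
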